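(* Let $\sum_{n=1}^\infty a_n$ be a series of positive numbers and let $K\geq 1$ be an integer. Suppose that, for all sufficiently large $n$, the ratio $a_n/a_{n+1}$ is presented in the form $$\frac{a_n}{a_{n+1}}=1+\frac{1}{n}+\frac{1}{n}\sum_{i=1}^{K-1}\frac{1}{\prod_{k=1}^{i}\ln_{(k)}n}+\frac{s_n}{n\prod_{k=1}^{K}\ln_{(k)}n},$$ where $(s_n)$ is a sequence of real numbers. Then the series $\sum_{n=1}^\infty a_n$ converges if $\liminf_{n\to\infty}s_n>1$, and it diverges if $\limsup_{n\to\infty}s_n<1$.
   Context: $\ln_{(k)}x$ denotes the $k$th iterate of the natural logarithm: $\ln_{(1)}x=\ln x$, and $\ln_{(k)}x=\ln_{(k-1)}(\ln x)$ for $k\geq 2$. "Sufficiently large $n$" is understood to include that $\ln_{(K)}n$ is defined and positive. The empty sum (which occurs when $K=1$) is $0$. *)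

theory Defs
  imports "HOL-Analysis.Analysis"
begin

definition iterated_ln :: "nat \<Rightarrow> real \<Rightarrow> real" where
  "iterated_ln k = ln ^^ k"

lemma iterated_ln_1: "iterated_ln 1 x = ln x"
  by (simp add: iterated_ln_def)

lemma iterated_ln_rec:
  assumes "k \<ge> 2"
  shows "iterated_ln k x = iterated_ln (k - 1) (ln x)"
proof -
  obtain j where "k = Suc j"
    using assms by (cases k) auto
  then show ?thesis
    by (simp add: iterated_ln_def funpow_swap1)
qed

lemma filterlim_iterated_ln: "filterlim (iterated_ln k) at_top at_top"
proof (induction k)
  case 0
  show ?case by (simp add: iterated_ln_def filterlim_ident id_def)
next
  case (Suc k)
  have "filterlim (\<lambda>x. ln (iterated_ln k x)) at_top at_top"
    by (rule filterlim_compose[OF ln_at_top Suc])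
  then show ?case by (simp add: iterated_ln_def o_def)
qed

(* HOL's ln is total. By this lemma all logarithms up to any fixed order are taken at positive
   arguments and have positive values once n is large, so the values that HOL assigns to ln
   outside the positive reals do not affect statements about all sufficiently large n. *)
lemma eventually_iterated_ln_pos:
  "\<forall>\<^sub>F n in sequentially. \<forall>k\<in>{..K}. iterated_ln k (real n) > 0"
proof (rule eventually_ball_finite)
  show "\<forall>k\<in>{..K}. \<forall>\<^sub>F n in sequentially. iterated_ln k (real n) > 0"
  proof
    fix k
    have "filterlim (\<lambda>n. iterated_ln k (real n)) at_top sequentially"
      by (rule filterlim_compose[OF filterlim_iterated_ln filterlim_real_sequentially])
    then show "\<forall>\<^sub>F n in sequentially. iterated_ln k (real n) > 0"
      by (simp add: filterlim_at_top_dense)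
  qed
qed simp

end

theory Submission
  imports Defs
begin

text \<open>
  Write \<open>L\<^sub>k\<close> for the \<open>k\<close>-th iterated logarithm (with \<open>L\<^sub>0 x = x\<close>) and
  \<open>P\<^sub>K = L\<^sub>0 L\<^sub>1 \<cdots> L\<^sub>K\<close>. The theorem is Kummer's test for the weights \<open>P\<^sub>K n\<close>. It rests on two facts.

  First, \<open>L\<^sub>k' = 1 / P\<^bsub>k-1\<^esub>\<close>, so the logarithmic derivative of \<open>P\<^sub>K\<close> is \<open>1/P\<^sub>0 + \<cdots> + 1/P\<^sub>K\<close>. The
  assumption on the ratio therefore reads \<open>P\<^sub>K n \<cdot> a\<^sub>n / a\<^bsub>n+1\<^esub> = P\<^sub>K n + P\<^sub>K' n - 1 + s\<^sub>n\<close>: the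
  right-hand side is the linear extrapolation of \<open>P\<^sub>K\<close> from \<open>n\<close> to \<open>n + 1\<close>, shifted by \<open>s\<^sub>n - 1\<close>. As
  \<open>P\<^sub>K''\<close> tends to zero (it is at most of the order of a power of \<open>ln x\<close> over \<open>x\<close>), the extrapolation error
  tends to zero, and Kummer's expression
  \<open>P\<^sub>K n \<cdot> a\<^sub>n / a\<^bsub>n+1\<^esub> - P\<^sub>K (n + 1)\<close> is \<open>s\<^sub>n - 1 + o(1)\<close>. Its lower and upper limits are
  those of \<open>s\<^sub>n\<close> minus one.

  Second, \<open>1 / P\<^sub>K\<close> is the derivative of the unbounded function \<open>L\<^bsub>K+1\<^esub>\<close> and is eventually decreasing, so the sum
  of \<open>1 / P\<^sub>K n\<close> diverges, as Kummer's divergence test requires of its weights.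
\<close>

section \<open>Iterated logarithms and their products\<close>

lemma iterated_ln_0 [simp]: "iterated_ln 0 x = x"
  by (simp add: iterated_ln_def)

lemma iterated_ln_Suc: "iterated_ln (Suc k) x = ln (iterated_ln k x)"
  by (simp add: iterated_ln_def)

definition log_product :: "nat \<Rightarrow> real \<Rightarrow> real" where
  "log_product K x = (\<Prod>k\<le>K. iterated_ln k x)"

text \<open>
  The first two derivatives of \<open>log_product\<close>, in the recursive form in which the product rule
  produces them. The summands \<open>1\<close> and \<open>log_product_deriv K x / log_product K x\<close> arise from
  \<open>L\<^bsub>K+1\<^esub>' = 1 / P\<^sub>K\<close>.
\<close>

primrec log_product_deriv :: "nat \<Rightarrow> real \<Rightarrow> real" where
  "log_product_deriv 0 x = 1"
| "log_product_deriv (Suc K) x = log_product_deriv K x * iterated_ln (Suc K) x + 1"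

primrec log_product_deriv2 :: "nat \<Rightarrow> real \<Rightarrow> real" where
  "log_product_deriv2 0 x = 0"
| "log_product_deriv2 (Suc K) x =
     log_product_deriv2 K x * iterated_ln (Suc K) x + log_product_deriv K x / log_product K x"

lemma log_product_0 [simp]: "log_product 0 x = x"
  by (simp add: log_product_def)

lemma log_product_Suc: "log_product (Suc K) x = log_product K x * iterated_ln (Suc K) x"
  by (simp add: log_product_def)

lemma log_product_eq: "log_product K x = x * (\<Prod>k=1..K. iterated_ln k x)"
  by (induction K) (simp_all add: log_product_Suc)

lemma log_product_pos:
  assumes "\<And>k. k \<le> K \<Longrightarrow> iterated_ln k x > 0"
  shows "log_product K x > 0"
  unfolding log_product_def using assms by (intro prod_pos) auto

lemma eventually_iterated_ln_ge:
  "\<forall>\<^sub>F x in at_top. \<forall>k\<le>K. iterated_ln k x \<ge> c"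
proof -
  have "\<forall>\<^sub>F x in at_top. \<forall>k\<in>{..K}. iterated_ln k x \<ge> c"
    by (rule eventually_ball_finite)
       (use filterlim_iterated_ln in \<open>auto simp: filterlim_at_top\<close>)
  then show ?thesis by (simp add: Ball_def)
qed

lemma iterated_ln_pos_above:
  "\<exists>X. \<forall>x\<ge>X. \<forall>k\<le>K. iterated_ln k x > 0"
  using eventually_iterated_ln_ge[of K 1] unfolding eventually_at_top_linorder
  by (meson less_le_trans zero_less_one)

lemma iterated_ln_mono:
  assumes "\<And>j. j < k \<Longrightarrow> iterated_ln j x > 0" and "x \<le> y"
  shows "iterated_ln k x \<le> iterated_ln k y"
  using assms
proof (induction k)
  case (Suc k)
  have "iterated_ln k x \<le> iterated_ln k y" "iterated_ln k x > 0"
    using Suc by simp_all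
  then show ?case by (simp add: iterated_ln_Suc)
qed simp

lemma log_product_mono:
  assumes "\<And>j. j \<le> K \<Longrightarrow> iterated_ln j x > 0" and "x \<le> y"
  shows "log_product K x \<le> log_product K y"
  unfolding log_product_def
proof (rule prod_mono)
  fix k assume "k \<in> {..K}"
  then show "0 \<le> iterated_ln k x \<and> iterated_ln k x \<le> iterated_ln k y"
    using assms iterated_ln_mono[of k x y] by (simp add: less_imp_le)
qed

text \<open>
  As \<open>ln y \<le> y\<close> for positive \<open>y\<close>, taking further logarithms only decreases the value. This
  lets powers of \<open>ln x\<close> bound all products of iterated logarithms.
\<close>

lemma iterated_ln_le_ln:
  assumes "\<And>j. j \<le> k \<Longrightarrow> iterated_ln j x > 0"
  shows "iterated_ln (Suc k) x \<le> ln x"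
  using assms
proof (induction k)
  case (Suc k)
  have "ln (iterated_ln (Suc k) x) \<le> iterated_ln (Suc k) x"
    using Suc.prems[of "Suc k"] by (intro ln_bound) simp
  also have "\<dots> \<le> ln x"
    using Suc by simp
  finally show ?case by (simp add: iterated_ln_Suc)
qed (simp add: iterated_ln_Suc)


section \<open>Derivatives\<close>

lemma has_real_derivative_iterated_ln:
  assumes "\<And>j. j \<le> K \<Longrightarrow> iterated_ln j x > 0"
  shows "(iterated_ln (Suc K) has_real_derivative 1 / log_product K x) (at x)"
  using assms
proof (induction K)
  case 0
  then show ?case
    by (auto simp: iterated_ln_def divide_inverse intro!: derivative_eq_intros)
next
  case (Suc K)
  have "(iterated_ln (Suc K) has_real_derivative 1 / log_product K x) (at x)"
    using Suc by simp
  moreover have "iterated_ln (Suc K) x > 0"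
    using Suc.prems by simp
  ultimately have "((\<lambda>x. ln (iterated_ln (Suc K) x)) has_real_derivative
      1 / log_product (Suc K) x) (at x)"
    by (auto intro!: derivative_eq_intros simp: log_product_Suc)
  then show ?case by (simp add: iterated_ln_Suc[abs_def, of "Suc K"])
qed

lemma has_real_derivative_log_product:
  assumes "\<And>j. j \<le> K \<Longrightarrow> iterated_ln j x > 0"
  shows "(log_product K has_real_derivative log_product_deriv K x) (at x)"
  using assms
proof (induction K)
  case 0
  then show ?case by (simp add: log_product_0[abs_def])
next
  case (Suc K)
  have "log_product K x > 0"
    using Suc.prems by (intro log_product_pos) simp
  moreover have "(log_product K has_real_derivative log_product_deriv K x) (at x)"
    "(iterated_ln (Suc K) has_real_derivative 1 / log_product K x) (at x)"
    using Suc has_real_derivative_iterated_ln by simp_all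
  ultimately show ?case
    by (auto intro!: derivative_eq_intros simp: log_product_Suc[abs_def])
qed

lemma has_real_derivative_log_product_deriv:
  assumes "\<And>j. j \<le> K \<Longrightarrow> iterated_ln j x > 0"
  shows "(log_product_deriv K has_real_derivative log_product_deriv2 K x) (at x)"
  using assms
proof (induction K)
  case 0
  have "log_product_deriv 0 = (\<lambda>_. 1)" by (rule ext) simp
  then show ?case by simp
next
  case (Suc K)
  have "log_product_deriv (Suc K) =
      (\<lambda>x. log_product_deriv K x * iterated_ln (Suc K) x + 1)"
    by (rule ext) simp
  moreover have "(log_product_deriv K has_real_derivative log_product_deriv2 K x) (at x)"
    "(iterated_ln (Suc K) has_real_derivative 1 / log_product K x) (at x)"
    using Suc has_real_derivative_iterated_ln by simp_all
  ultimately show ?case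
    by (auto intro!: derivative_eq_intros)
qed

lemma log_product_deriv_quotient:
  assumes "\<And>j. j \<le> K \<Longrightarrow> iterated_ln j x > 0"
  shows "log_product_deriv K x / log_product K x = (\<Sum>i\<le>K. 1 / log_product i x)"
  using assms
proof (induction K)
  case (Suc K)
  have "iterated_ln (Suc K) x > 0" using Suc.prems by simp
  then have "log_product_deriv (Suc K) x / log_product (Suc K) x =
      log_product_deriv K x / log_product K x + 1 / log_product (Suc K) x"
    by (simp add: log_product_Suc add_divide_distrib)
  then show ?case using Suc by simp
qed simp


section \<open>Decay of the second derivative\<close>

lemma tendsto_ln_power_over_log_product:
  "((\<lambda>x. ln x ^ m / log_product K x) \<longlongrightarrow> 0) at_top"
proof (rule Lim_null_comparison)
  show "((\<lambda>x::real. ln x ^ m / x) \<longlongrightarrow> 0) at_top"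
  proof (rule Lim_transform_eventually)
    show "((\<lambda>x. ln x ^ m / exp (ln x)) \<longlongrightarrow> (0::real)) at_top"
      by (rule filterlim_compose[OF tendsto_power_div_exp_0 ln_at_top])
    show "\<forall>\<^sub>F x in at_top. ln x ^ m / exp (ln x) = ln x ^ m / (x::real)"
      using eventually_gt_at_top[of "0::real"] by eventually_elim simp
  qed
  show "\<forall>\<^sub>F x in at_top. norm (ln x ^ m / log_product K x) \<le> ln x ^ m / x"
    using eventually_iterated_ln_ge[of K 1] eventually_ge_at_top[of 1]
  proof eventually_elim
    case (elim x)
    have "x * 1 \<le> log_product K x"
      unfolding log_product_eq using elim by (intro mult_left_mono prod_ge_1) auto
    then show ?case
      using elim by (simp add: divide_left_mono)
  qed
qed

text \<open>
  The induction on \<open>K\<close> multiplies by one more iterated logarithm in each step. The arbitrary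
  power of \<open>ln x\<close> in the statement absorbs it.
\<close>

lemma tendsto_log_product_deriv2_times_ln_power:
  "((\<lambda>x. log_product_deriv2 K x * ln x ^ m) \<longlongrightarrow> 0) at_top"
proof (induction K arbitrary: m)
  case (Suc K)
  have "((\<lambda>x. log_product_deriv2 K x * iterated_ln (Suc K) x * ln x ^ m) \<longlongrightarrow> 0) at_top"
  proof (rule Lim_null_comparison)
    show "((\<lambda>x. norm (log_product_deriv2 K x * ln x ^ Suc m)) \<longlongrightarrow> 0) at_top"
      using Suc by (rule tendsto_norm_zero)
    show "\<forall>\<^sub>F x in at_top. norm (log_product_deriv2 K x * iterated_ln (Suc K) x * ln x ^ m)
        \<le> norm (log_product_deriv2 K x * ln x ^ Suc m)"
      using eventually_iterated_ln_ge[of "Suc K" 1]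
    proof eventually_elim
      case (elim x)
      then have pos: "iterated_ln j x > 0" if "j \<le> Suc K" for j
        using that by (meson less_le_trans zero_less_one)
      have "0 < iterated_ln (Suc K) x" "iterated_ln (Suc K) x \<le> ln x"
        using pos by (auto intro: iterated_ln_le_ln)
      then show ?case
        by (auto simp: abs_mult mult.assoc intro!: mult_left_mono mult_right_mono)
    qed
  qed
  moreover have
    "((\<lambda>x. log_product_deriv K x / log_product K x * ln x ^ m) \<longlongrightarrow> 0) at_top"
  proof (rule Lim_transform_eventually)
    show "((\<lambda>x. \<Sum>i\<le>K. ln x ^ m / log_product i x) \<longlongrightarrow> 0) at_top"
      by (intro tendsto_null_sum tendsto_ln_power_over_log_product)
    show "\<forall>\<^sub>F x in at_top. (\<Sum>i\<le>K. ln x ^ m / log_product i x) =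
        log_product_deriv K x / log_product K x * ln x ^ m"
      using eventually_iterated_ln_ge[of K 1]
    proof eventually_elim
      case (elim x)
      then have "iterated_ln j x > 0" if "j \<le> K" for j
        using that by (meson less_le_trans zero_less_one)
      then show ?case
        by (simp add: log_product_deriv_quotient sum_distrib_right)
    qed
  qed
  ultimately show ?case
    using tendsto_add_zero by (fastforce simp: distrib_right)
qed simp

lemma tendsto_log_product_deriv2: "(log_product_deriv2 K \<longlongrightarrow> 0) at_top"
  using tendsto_log_product_deriv2_times_ln_power[of K 0] by simp

text \<open>
  Two applications of the mean value theorem express the error of linear extrapolation over a
  unit step as \<open>f''(\<eta>) (\<xi> - x)\<close> with \<open>x < \<eta> < \<xi> < x + 1\<close>.
\<close>

lemma tendsto_linear_extrapolation_error:
  fixes f f' f'' :: "real \<Rightarrow> real"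
  assumes f: "\<And>x. x \<ge> X \<Longrightarrow> (f has_real_derivative f' x) (at x)"
    and f': "\<And>x. x \<ge> X \<Longrightarrow> (f' has_real_derivative f'' x) (at x)"
    and lim: "(f'' \<longlongrightarrow> 0) at_top"
  shows "((\<lambda>x. f (x + 1) - f x - f' x) \<longlongrightarrow> 0) at_top"
proof (rule tendstoI)
  fix e :: real assume "e > 0"
  with lim have "\<forall>\<^sub>F x in at_top. \<bar>f'' x\<bar> < e"
    by (auto dest: tendstoD simp: dist_real_def)
  then obtain Y where Y: "\<And>x. x \<ge> Y \<Longrightarrow> \<bar>f'' x\<bar> < e"
    by (auto simp: eventually_at_top_linorder)
  show "\<forall>\<^sub>F x in at_top. dist (f (x + 1) - f x - f' x) 0 < e"
    using eventually_ge_at_top[of "max X Y"]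
  proof eventually_elim
    case (elim x)
    have "\<exists>\<xi>>x. \<xi> < x + 1 \<and> f (x + 1) - f x = (x + 1 - x) * f' \<xi>"
      using elim by (intro MVT2 f) auto
    then obtain \<xi> where \<xi>: "x < \<xi>" "\<xi> < x + 1" "f (x + 1) - f x = f' \<xi>"
      by auto
    have "\<exists>\<eta>>x. \<eta> < \<xi> \<and> f' \<xi> - f' x = (\<xi> - x) * f'' \<eta>"
      using elim \<xi> by (intro MVT2 f') auto
    then obtain \<eta> where \<eta>: "x < \<eta>" "f' \<xi> - f' x = (\<xi> - x) * f'' \<eta>"
      by auto
    have "\<bar>(\<xi> - x) * f'' \<eta>\<bar> \<le> 1 * \<bar>f'' \<eta>\<bar>"
      unfolding abs_mult using \<xi> by (intro mult_right_mono) auto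
    also have "\<dots> < e" using Y[of \<eta>] elim \<eta> by simp
    finally show ?case using \<xi> \<eta> by (simp add: dist_real_def)
  qed
qed

lemma log_product_step:
  "((\<lambda>x. log_product K (x + 1) - log_product K x - log_product_deriv K x) \<longlongrightarrow> 0) at_top"
proof -
  obtain X where "\<And>x k. x \<ge> X \<Longrightarrow> k \<le> K \<Longrightarrow> iterated_ln k x > 0"
    using iterated_ln_pos_above by blast
  then show ?thesis
    by (intro tendsto_linear_extrapolation_error[OF _ _ tendsto_log_product_deriv2])
       (auto intro: has_real_derivative_log_product has_real_derivative_log_product_deriv)
qed


section \<open>Divergence of the sum of reciprocal weights\<close>

text \<open>
  By the mean value theorem the increments of \<open>iterated_ln (Suc K)\<close> are bounded by
  \<open>1 / log_product K n\<close>, and these increments telescope to a sequence without limit.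
\<close>

lemma not_summable_inverse_log_product:
  "\<not> summable (\<lambda>n. inverse (log_product K (real n)))"
proof
  let ?L = "\<lambda>n::nat. iterated_ln (Suc K) (real n)"
  assume "summable (\<lambda>n. inverse (log_product K (real n)))"
  moreover have "\<forall>\<^sub>F n in sequentially.
      norm (?L (Suc n) - ?L n) \<le> inverse (log_product K (real n))"
  proof -
    obtain X where X: "\<And>x k. x \<ge> X \<Longrightarrow> k \<le> K \<Longrightarrow> iterated_ln k x > 0"
      using iterated_ln_pos_above by blast
    have "\<forall>\<^sub>F n in sequentially. real n \<ge> X"
      using filterlim_real_sequentially by (simp add: filterlim_at_top)
    then show ?thesis
    proof eventually_elim
      case (elim n)
      have "\<exists>z>real n. z < real n + 1 \<and> iterated_ln (Suc K) (real n + 1) - ?L n =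
          (real n + 1 - real n) * (1 / log_product K z)"
        using elim X by (intro MVT2 has_real_derivative_iterated_ln) auto
      then obtain z where z: "z > real n"
        "iterated_ln (Suc K) (real n + 1) - ?L n = 1 / log_product K z"
        by auto
      have "0 < log_product K (real n)" "log_product K (real n) \<le> log_product K z"
        using X elim z by (auto intro: log_product_pos log_product_mono)
      then show ?case
        using z by (simp add: add.commute inverse_eq_divide frac_le)
    qed
  qed
  ultimately have "summable (\<lambda>n. ?L (Suc n) - ?L n)"
    by (rule summable_comparison_test_ev[rotated])
  then have "convergent (\<lambda>n. \<Sum>i<n. ?L (Suc i) - ?L i)"
    by (simp add: summable_iff_convergent)
  then have "convergent (\<lambda>n. ?L n - ?L 0)"
    by (simp only: sum_lessThan_telescope[of ?L])
  then obtain c where "(\<lambda>n. ?L n - ?L 0) \<longlonglongrightarrow> c"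
    by (auto simp: convergent_def)
  then have "(\<lambda>n. (?L n - ?L 0) + ?L 0) \<longlonglongrightarrow> c + ?L 0"
    by (intro tendsto_intros)
  then have "?L \<longlonglongrightarrow> c + ?L 0" by simp
  moreover have "filterlim ?L at_top sequentially"
    by (rule filterlim_compose[OF filterlim_iterated_ln filterlim_real_sequentially])
  ultimately show False
    using not_tendsto_and_filterlim_at_infinity[OF sequentially_bot]
      filterlim_at_top_imp_at_infinity by blast
qed


section \<open>Kummer's test with the weights \<open>log_product K\<close>\<close>

text \<open>
  The sum over \<open>i\<close> together with \<open>1 / x\<close> is the logarithmic derivative of \<open>log_product K\<close> without its last summand \<open>1 / log_product K x\<close>, which becomes the
  \<open>- 1\<close> on the right.
\<close>

lemma log_product_times_ratio:
  assumes pos: "\<And>j. j \<le> K \<Longrightarrow> iterated_ln j x > 0" and "K \<ge> 1"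
  shows "log_product K x *
      (1 + 1 / x + (1 / x) * (\<Sum>i = 1..K - 1. 1 / (\<Prod>k = 1..i. iterated_ln k x))
        + t / (x * (\<Prod>k = 1..K. iterated_ln k x)))
    = log_product K x + log_product_deriv K x - 1 + t"
proof -
  have P: "log_product K x > 0"
    using pos by (rule log_product_pos)
  have "1 / x + (1 / x) * (\<Sum>i = 1..K - 1. 1 / (\<Prod>k = 1..i. iterated_ln k x)) =
      1 / log_product 0 x + (\<Sum>i = 1..K - 1. 1 / log_product i x)"
    by (simp add: log_product_eq sum_distrib_left)
  also have "\<dots> = (\<Sum>i\<le>K - 1. 1 / log_product i x)"
    by (simp add: atMost_atLeast0 sum.atLeast_Suc_atMost)
  also have "\<dots> = (\<Sum>i\<le>K. 1 / log_product i x) - 1 / log_product K x"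
    using \<open>K \<ge> 1\<close> by (cases K) simp_all
  also have "\<dots> = (log_product_deriv K x - 1) / log_product K x"
    using log_product_deriv_quotient[OF pos] by (simp add: diff_divide_distrib)
  finally have sum: "1 / x + (1 / x) * (\<Sum>i = 1..K - 1. 1 / (\<Prod>k = 1..i. iterated_ln k x)) =
      (log_product_deriv K x - 1) / log_product K x" .
  show ?thesis
    unfolding add.assoc[of 1] sum log_product_eq[symmetric] using P by (simp add: field_simps)
qed

theorem theorem2:
  fixes a s :: "nat \<Rightarrow> real" and K :: nat
  assumes pos: "\<And>n. n \<ge> 1 \<Longrightarrow> a n > 0"
    and K: "K \<ge> 1"
    and ratio: "\<forall>\<^sub>F n in sequentially.
      a n / a (n + 1) =
        1 + 1 / real n
        + (1 / real n) * (\<Sum>i = 1..K - 1. 1 / (\<Prod>k = 1..i. iterated_ln k (real n)))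
        + s n / (real n * (\<Prod>k = 1..K. iterated_ln k (real n)))"
  shows "(liminf (\<lambda>n. ereal (s n)) > 1 \<longrightarrow> summable (\<lambda>n. a (n + 1)))
    \<and> (limsup (\<lambda>n. ereal (s n)) < 1 \<longrightarrow> \<not> summable (\<lambda>n. a (n + 1)))"
proof -
  define p where "p n = log_product K (real n)" for n
  define d where "d n = - 1 - (p (Suc n) - p n - log_product_deriv K (real n))" for n
  have kummer: "\<forall>\<^sub>F n in sequentially.
      ereal (p n * a n / a (Suc n) - p (Suc n)) = ereal (d n) + ereal (s n)"
    using ratio eventually_iterated_ln_pos[of K]
  proof eventually_elim
    case (elim n)
    have "p n * (a n / a (n + 1)) = p n + log_product_deriv K (real n) - 1 + s n"
      unfolding elim(1) p_def using elim(2) K by (intro log_product_times_ratio) auto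
    then show ?case by (simp add: d_def)
  qed
  have "(\<lambda>n. p (Suc n) - p n - log_product_deriv K (real n)) \<longlonglongrightarrow> 0"
    using filterlim_compose[OF log_product_step[of K] filterlim_real_sequentially]
    by (simp add: p_def add.commute)
  then have "d \<longlonglongrightarrow> - 1 - 0"
    unfolding d_def by (intro tendsto_intros)
  then have d: "(\<lambda>n. ereal (d n)) \<longlonglongrightarrow> - 1"
    by (simp add: one_ereal_def)
  have liminf: "liminf (\<lambda>n. ereal (p n * a n / a (Suc n) - p (Suc n))) =
      - 1 + liminf (\<lambda>n. ereal (s n))"
    unfolding Liminf_eq[OF kummer] using d by (rule ereal_liminf_lim_add) simp
  have limsup: "limsup (\<lambda>n. ereal (p n * a n / a (Suc n) - p (Suc n))) =
      - 1 + limsup (\<lambda>n. ereal (s n))"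
    unfolding Limsup_eq[OF kummer] using d by (rule ereal_limsup_lim_add) simp
  have a_pos: "\<forall>\<^sub>F n in sequentially. a n > 0"
    using eventually_ge_at_top[of 1] by eventually_elim (rule pos)
  have p_pos: "\<forall>\<^sub>F n in sequentially. p n > 0"
    using eventually_iterated_ln_pos[of K]
    by eventually_elim (auto simp: p_def intro: log_product_pos)
  have shift: "summable (\<lambda>n. a (n + 1)) \<longleftrightarrow> summable a"
    using summable_Suc_iff[of a] by simp
  show ?thesis
    unfolding shift
  proof (intro conjI impI)
    assume "liminf (\<lambda>n. ereal (s n)) > 1"
    then have "0 < - 1 + liminf (\<lambda>n. ereal (s n))"
      by (cases "liminf (\<lambda>n. ereal (s n))") (auto simp: one_ereal_def)
    moreover have "\<forall>\<^sub>F n in sequentially. p n \<ge> 0"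
      using p_pos by eventually_elim simp
    ultimately show "summable a"
      using kummers_test_convergence[OF a_pos] liminf by metis
  next
    assume "limsup (\<lambda>n. ereal (s n)) < 1"
    then have "- 1 + limsup (\<lambda>n. ereal (s n)) < 0"
      by (cases "limsup (\<lambda>n. ereal (s n))") (auto simp: one_ereal_def)
    moreover have "\<not> summable (\<lambda>n. inverse (p n))"
      unfolding p_def by (rule not_summable_inverse_log_product)
    ultimately show "\<not> summable a"
      using kummers_test_divergence[OF a_pos p_pos] limsup by metis
  qed
qed

end
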